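(* Suppose that $\nabla E$ is Lipschitz on the Stiefel manifold, i.e. there is $L_0>0$ with $\|\nabla E(U)-\nabla E(V)\|_F\le L_0\|U-V\|_F$ for all $U,V\in\mathcal M^N_{N_g}$. Let $[U^\ast]$ be a local minimizer of $E$ and suppose there are $\delta_1>0$, $\nu_1>0$ such that $\nabla^2_GE(U)[D,D]\ge\nu_1\|D\|_F^2$ for all $[U]\in B([U^\ast],\delta_1)$ and all $D\in\mathcal T_{[U]}\mathcal G^N_{N_g}$. Suppose the retraction $\mathrm{ortho}$ satisfies, for some constant $C_1>0$ and all $U\in\mathcal M^N_{N_g}$, $D\in\mathcal T_{[U]}\mathcal G^N_{N_g}$, $t\ge 0$, $$\|\mathrm{ortho}(U,D,t)-U\|_F\le C_1t\|D\|_F,\qquad \Big\|\frac{\partial}{\partial t}\mathrm{ortho}(U,D,t)-D\Big\|_F\le C_1t\|D\|_F^2 .$$ Let $\delta_2$ and the level set $\mathcal L$ be as in the context. If $[U_0]\in B([U^\ast],\delta_2)\cap\mathcal L$, then there exists a sequence $\{\sigma_n\}_{n\in\mathbb N_0}\subset(0,1)$ such that, for the sequence $\{U_n\}_{n\in\mathbb N_0}$ generated by the Newton method described in the context with this choice of $\{\sigma_n\}$, either $\|\nabla_GE(U_n)\|_F=0$ for some $n$, or $$\lim_{n\to\infty}\|\nabla_GE(U_n)\|_F=0 .$$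
   Context: Energy. Let $N\le N_g$ be positive integers and $\mathcal M^N_{N_g}=\{U\in\mathbb R^{N_g\times N}:U^TU=I_N\}$. The discretized Kohn–Sham energy is $$E(U)=\tfrac12\mathrm{tr}(U^TLU)+\mathrm{tr}(U^TV_{ext}U)+\tfrac12\rho(U)^TL^\dagger\rho(U)+\rho(U)^T\varepsilon_{xc}(\rho(U)),\quad \rho(U)=\mathrm{diag}(UU^T)\in\mathbb R^{N_g},$$ with $L,V_{ext}\in\mathbb R^{N_g\times N_g}$ symmetric, $L^\dagger$ the generalized inverse of $L$, and $\varepsilon_{xc}(\rho)\in\mathbb R^{N_g}$ a given function of $\rho$; $E$ is assumed sufficiently smooth (at least $C^3$). Here $\mathrm{diag}(A)$ is the column vector of diagonal entries. One has $E(UP)=E(U)$ for orthogonal $P$. Geometry. $\mathcal O^N$ is the set of orthogonal $N\times N$ matrices, $[U]=\{UP:P\in\mathcal O^N\}$, and $\mathcal G^N_{N_g}=\mathcal M^N_{N_g}/\!\sim$ is the Grassmann manifold of classes $[U]$. Tangent space: $\mathcal T_{[U]}\mathcal G^N_{N_g}=\{W\in\mathbb R^{N_g\times N}:W^TU=0\}$. $\langle A,B\rangle=\mathrm{tr}(A^TB)$, $\|\cdot\|_F$ is the Frobenius norm. $\nabla E,\nabla^2E$ are the Euclidean gradient and Hessian (the latter as a linear map $D\mapsto\nabla^2E(U)[D]$). $\nabla_GE(U)=(I-UU^T)\nabla E(U)$; for $D,D_1,D_2\in\mathcal T_{[U]}\mathcal G^N_{N_g}$, $\nabla_G^2E(U)[D]=(I-UU^T)\nabla^2E(U)[D]-D\,U^T\nabla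 E(U)$ and $\nabla_G^2E(U)[D_1,D_2]=\langle\nabla_G^2E(U)[D_1],D_2\rangle$. $\mathrm{dist}_F([U],[V])=\min_{P\in\mathcal O^N}\|U-VP\|_F$ and $B([U],\delta)=\{[V]:\mathrm{dist}_F([V],[U])\le\delta\}$. Constants. $C_0>0$ is a constant with $\|\nabla E(\Psi)\|_F\le C_0$ for all $\Psi\in\mathcal M^N_{N_g}$, and $L_1=L_0+2C_0$. $\delta_2$ is any fixed number in $\big(0,\delta_1/(1+\tfrac{3C_1}{\nu_1}L_1)\big)$, and $E_0>E(U^\ast)$ is fixed such that the level set $\mathcal L=\{[U]\in\mathcal G^N_{N_g}:E(U)\le E_0\}$ satisfies $\mathcal L\cap B([U^\ast],\delta_1)\subset B([U^\ast],\delta_2)$ (such an $E_0$ exists). Retraction. $\mathrm{ortho}(U,D,t)\in\mathcal M^N_{N_g}$ is defined for $U\in\mathcal M^N_{N_g}$, $D\in\mathcal T_{[U]}\mathcal G^N_{N_g}$, $t\in\mathbb R$, is smooth, and satisfies $\mathrm{ortho}(U,D,0)=U$, $\frac{\partial}{\partial t}\mathrm{ortho}(U,D,0)=D$. Newton method. Fix $q\in(0,1)$, $\eta\in(0,\frac14)$ and $U_0\in\mathcal M^N_{N_g}$. For $n=0,1,2,\dots$, while $\|\nabla_GE(U_n)\|_F\neq0$: choose $\sigma_n\in(0,1)$ (which may depend on the iterates computed so far); take any $D_n\in\mathcal T_{[U_n]}\mathcal G^N_{N_g}$ with $\|\nabla_G^2E(U_n)[D_n]+\nabla_GE(U_n)\|_F\le\sigma_n\|\nabla_GE(U_n)\|_F$;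 set $t_n^{\rm init}=-\langle\nabla_GE(U_n),D_n\rangle/\nabla_G^2E(U_n)[D_n,D_n]$ and $t_n=t_n^{\rm init}q^{m_n}$, where $m_n$ is the smallest nonnegative integer such that $E(\mathrm{ortho}(U_n,D_n,t_n))\le E(U_n)+\eta t_n\langle\nabla_GE(U_n),D_n\rangle$; set $U_{n+1}=\mathrm{ortho}(U_n,D_n,t_n)$. *)

theory Defs
  imports "HOL-Analysis.Analysis"
begin

text \<open>
  Matrices with \<open>N\<^sub>g\<close> rows and \<open>N\<close> columns have type \<open>real ^ 'n ^ 'g\<close>, where
  \<open>N = CARD('n)\<close> and \<open>N\<^sub>g = CARD('g)\<close>. On this type the library's \<open>inner\<close> and \<open>norm\<close>
  are the trace inner product and the Frobenius norm, see \<open>inner_eq_trace\<close> below.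
\<close>

section \<open>Matrix preliminaries\<close>

lemma inner_eq_trace: "inner A B = trace (transpose A ** B)" for A B :: "real ^ 'n ^ 'g"
proof -
  have "inner A B = (\<Sum>i\<in>UNIV. \<Sum>j\<in>UNIV. A $ i $ j * B $ i $ j)"
    by (simp add: inner_vec_def)
  also have "\<dots> = (\<Sum>j\<in>UNIV. \<Sum>i\<in>UNIV. A $ i $ j * B $ i $ j)"
    by (rule sum.swap)
  finally show ?thesis
    by (simp add: trace_def matrix_matrix_mult_def transpose_def)
qed

lemma norm_mult_orthogonal:
  fixes A :: "real ^ 'n ^ 'g" and P :: "real ^ 'n ^ 'n"
  assumes "orthogonal_matrix P"
  shows "norm (A ** P) = norm A"
proof -
  have "inner (A ** P) (A ** P) = trace (transpose P ** ((transpose A ** A) ** P))"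
    by (simp add: inner_eq_trace matrix_transpose_mul matrix_mul_assoc)
  also have "\<dots> = trace ((transpose A ** A) ** (P ** transpose P))"
    by (subst trace_mul_sym) (simp add: matrix_mul_assoc)
  also have "\<dots> = inner A A"
    using assms by (simp add: orthogonal_matrix_def inner_eq_trace)
  finally show ?thesis by (simp add: norm_eq)
qed

lemma compact_orthogonal_matrices: "compact {P :: real ^ 'n ^ 'n. orthogonal_matrix P}"
proof -
  have "norm P \<le> sqrt (real CARD('n))" if "orthogonal_matrix P" for P :: "real ^ 'n ^ 'n"
    using that by (simp add: norm_eq_sqrt_inner inner_eq_trace orthogonal_matrix_def trace_I)
  then have "bounded {P :: real ^ 'n ^ 'n. orthogonal_matrix P}"
    unfolding bounded_iff by blast
  moreover have "closed {P :: real ^ 'n ^ 'n. transpose P ** P = mat 1}"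
    unfolding matrix_matrix_mult_def transpose_def
    by (intro closed_Collect_eq continuous_intros)
  ultimately show ?thesis
    by (simp add: compact_eq_bounded_closed orthogonal_matrix)
qed

definition moore_penrose :: "real ^ 'a ^ 'b \<Rightarrow> real ^ 'b ^ 'a" where
  "moore_penrose A = (THE X. A ** X ** A = A \<and> X ** A ** X = X \<and>
     transpose (A ** X) = A ** X \<and> transpose (X ** A) = X ** A)"


section \<open>Differentiability\<close>

text \<open>
  On an open set of a finite-dimensional space, continuity of all iterated directional
  derivatives of order at most \<open>k\<close> is the usual notion of a \<open>C\<^sup>k\<close> function.
\<close>

primrec Ck_on ::
  "nat \<Rightarrow> ('a::euclidean_space \<Rightarrow> 'b::euclidean_space) \<Rightarrow> 'a set \<Rightarrow> bool" where
  "Ck_on 0 f S \<longleftrightarrow> continuous_on S f"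
| "Ck_on (Suc k) f S \<longleftrightarrow> f differentiable_on S \<and>
     (\<forall>v. Ck_on k (\<lambda>x. frechet_derivative f (at x) v) S)"

text \<open>
  A map on an arbitrary subset (used here for a submanifold) is smooth if it locally extends to
  a smooth map on an open set of the ambient space.
\<close>

definition smooth_on_subset ::
  "('a::euclidean_space \<Rightarrow> 'b::euclidean_space) \<Rightarrow> 'a set \<Rightarrow> bool" where
  "smooth_on_subset f A \<longleftrightarrow>
     (\<forall>x\<in>A. \<exists>T h. open T \<and> x \<in> T \<and> (\<forall>k. Ck_on k h T) \<and> (\<forall>y\<in>A \<inter> T. h y = f y))"

definition grad :: "('a::euclidean_space \<Rightarrow> real) \<Rightarrow> 'a \<Rightarrow> 'a" where
  "grad E x = (THE G. GDERIV E x :> G)"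

definition hess :: "('a::euclidean_space \<Rightarrow> real) \<Rightarrow> 'a \<Rightarrow> 'a \<Rightarrow> 'a" where
  "hess E x d = frechet_derivative (grad E) (at x) d"


section \<open>Stiefel and Grassmann manifolds\<close>

definition stiefel :: "(real ^ 'n ^ 'g) set" where
  "stiefel = {U. transpose U ** U = mat 1}"

definition gclass :: "real ^ 'n ^ 'g \<Rightarrow> (real ^ 'n ^ 'g) set" where
  "gclass U = {U ** P | P. orthogonal_matrix P}"

definition tangent :: "real ^ 'n ^ 'g \<Rightarrow> (real ^ 'n ^ 'g) set" where
  "tangent U = {W. transpose W ** U = 0}"

definition grass_dist :: "real ^ 'n ^ 'g \<Rightarrow> real ^ 'n ^ 'g \<Rightarrow> real" where
  "grass_dist U V = (INF P\<in>{P. orthogonal_matrix P}. norm (U - V ** P))"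

text \<open>The infimum is a minimum, and it depends on the classes of its arguments only.\<close>

lemma grass_dist_attained:
  fixes U V :: "real ^ 'n ^ 'g"
  shows "\<exists>P. orthogonal_matrix P \<and> grass_dist U V = norm (U - V ** P) \<and>
           (\<forall>Q. orthogonal_matrix Q \<longrightarrow> norm (U - V ** P) \<le> norm (U - V ** Q))"
proof -
  let ?O = "{P :: real ^ 'n ^ 'n. orthogonal_matrix P}"
  have "continuous_on ?O (\<lambda>P. norm (U - V ** P))"
    unfolding matrix_matrix_mult_def by (intro continuous_intros)
  moreover have "?O \<noteq> {}" using orthogonal_matrix_id by blast
  ultimately obtain P where P: "P \<in> ?O" "\<forall>Q\<in>?O. norm (U - V ** P) \<le> norm (U - V ** Q)"
    using continuous_attains_inf[OF compact_orthogonal_matrices] by blast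
  have "grass_dist U V = norm (U - V ** P)"
    unfolding grass_dist_def using P by (intro cInf_eq_minimum) auto
  with P show ?thesis by blast
qed

lemma gclass_eqD:
  assumes "gclass U = gclass U'"
  shows "\<exists>P. orthogonal_matrix P \<and> U' = U ** P"
proof -
  have "U' \<in> gclass U'"
    unfolding gclass_def using orthogonal_matrix_id matrix_mul_rid
    by (metis (mono_tags, lifting) mem_Collect_eq)
  with assms show ?thesis unfolding gclass_def by blast
qed

lemma grass_dist_le:
  assumes "orthogonal_matrix P" "orthogonal_matrix Q"
  shows "grass_dist (U ** P) (V ** Q) \<le> grass_dist U V"
proof -
  obtain R where R: "orthogonal_matrix R" "grass_dist U V = norm (U - V ** R)"
    using grass_dist_attained by blast
  define S where "S = transpose Q ** R ** P"
  have S: "orthogonal_matrix S"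
    unfolding S_def using assms R by (simp add: orthogonal_matrix_mul)
  obtain S' where S': "grass_dist (U ** P) (V ** Q) = norm (U ** P - (V ** Q) ** S')"
    "norm (U ** P - (V ** Q) ** S') \<le> norm (U ** P - (V ** Q) ** S)"
    using grass_dist_attained[of "U ** P" "V ** Q"] S by blast
  have "(V ** Q) ** S = V ** (Q ** transpose Q) ** R ** P"
    by (simp add: S_def matrix_mul_assoc)
  also have "\<dots> = V ** R ** P"
    using assms(2) by (simp add: orthogonal_matrix_def)
  finally have "U ** P - (V ** Q) ** S = (U - V ** R) ** P"
    by (simp add: vec_eq_iff matrix_matrix_mult_def left_diff_distrib sum_subtractf)
  then have "norm (U ** P - (V ** Q) ** S) = norm (U - V ** R)"
    using norm_mult_orthogonal[OF assms(1)] by metis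
  with R S' show ?thesis by simp
qed

lemma grass_dist_gclass_cong:
  assumes "gclass U = gclass U'" "gclass V = gclass V'"
  shows "grass_dist U V = grass_dist U' V'"
proof -
  have "grass_dist U' V' \<le> grass_dist U V" if "gclass U = gclass U'" "gclass V = gclass V'"
    for U U' V V' :: "real ^ 'n ^ 'g"
    using gclass_eqD[OF that(1)] gclass_eqD[OF that(2)] grass_dist_le by metis
  from this[OF assms] this[OF assms(1)[symmetric] assms(2)[symmetric]] show ?thesis
    by (rule antisym[rotated])
qed

definition grass_ball :: "real ^ 'n ^ 'g \<Rightarrow> real \<Rightarrow> (real ^ 'n ^ 'g) set set" where
  "grass_ball U \<delta> = {gclass V | V. V \<in> stiefel \<and> grass_dist V U \<le> \<delta>}"

definition grass_local_minimizer ::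
  "(real ^ 'n ^ 'g \<Rightarrow> real) \<Rightarrow> real ^ 'n ^ 'g \<Rightarrow> bool" where
  "grass_local_minimizer E U \<longleftrightarrow> U \<in> stiefel \<and>
     (\<exists>r>0. \<forall>V\<in>stiefel. gclass V \<in> grass_ball U r \<longrightarrow> E U \<le> E V)"

definition level_set :: "(real ^ 'n ^ 'g \<Rightarrow> real) \<Rightarrow> real \<Rightarrow> (real ^ 'n ^ 'g) set set" where
  "level_set E E0 = {gclass U | U. U \<in> stiefel \<and> E U \<le> E0}"

definition gradG :: "(real ^ 'n ^ 'g \<Rightarrow> real) \<Rightarrow> real ^ 'n ^ 'g \<Rightarrow> real ^ 'n ^ 'g" where
  "gradG E U = (mat 1 - U ** transpose U) ** grad E U"

definition hessG ::
  "(real ^ 'n ^ 'g \<Rightarrow> real) \<Rightarrow> real ^ 'n ^ 'g \<Rightarrow> real ^ 'n ^ 'g \<Rightarrow> real ^ 'n ^ 'g" where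
  "hessG E U D = (mat 1 - U ** transpose U) ** hess E U D - D ** (transpose U ** grad E U)"


section \<open>The discretized Kohn--Sham energy\<close>

definition density :: "real ^ 'n ^ 'g \<Rightarrow> real ^ 'g" where
  "density U = (\<chi> i. (U ** transpose U) $ i $ i)"

definition ks_energy ::
  "real ^ 'g ^ 'g \<Rightarrow> real ^ 'g ^ 'g \<Rightarrow> (real ^ 'g \<Rightarrow> real ^ 'g) \<Rightarrow> real ^ 'n ^ 'g \<Rightarrow> real" where
  "ks_energy L Vext exc U =
     1/2 * trace (transpose U ** L ** U) + trace (transpose U ** Vext ** U)
     + 1/2 * (density U \<bullet> (moore_penrose L *v density U))
     + density U \<bullet> exc (density U)"

text \<open>The energy is a function on classes.\<close>

lemma ks_energy_mult_orthogonal: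
  assumes "orthogonal_matrix P"
  shows "ks_energy L Vext exc (U ** P) = ks_energy L Vext exc U"
proof -
  have PP: "P ** transpose P = mat 1"
    using assms by (simp add: orthogonal_matrix_def)
  have "(U ** P) ** transpose (U ** P) = U ** (P ** transpose P) ** transpose U"
    by (simp add: matrix_transpose_mul matrix_mul_assoc)
  then have *: "density (U ** P) = density U"
    using PP by (simp add: density_def)
  have **: "trace (transpose (U ** P) ** A ** (U ** P)) = trace (transpose U ** A ** U)" for A
  proof -
    have "trace (transpose (U ** P) ** A ** (U ** P)) = trace (transpose P ** ((transpose U ** A ** U) ** P))"
      by (simp add: matrix_transpose_mul matrix_mul_assoc)
    also have "\<dots> = trace ((transpose U ** A ** U) ** (P ** transpose P))"
      by (subst trace_mul_sym) (simp add: matrix_mul_assoc)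
    finally show ?thesis by (simp add: PP)
  qed
  show ?thesis unfolding ks_energy_def * ** ..
qed


section \<open>The line search Newton method\<close>

text \<open>The inexact Newton directions at \<open>U\<close> with residual tolerance \<open>s\<close>.\<close>

definition newton_directions ::
  "(real ^ 'n ^ 'g \<Rightarrow> real) \<Rightarrow> real \<Rightarrow> real ^ 'n ^ 'g \<Rightarrow> (real ^ 'n ^ 'g) set" where
  "newton_directions E s U =
     {D \<in> tangent U. norm (hessG E U D + gradG E U) \<le> s * norm (gradG E U)}"

definition init_step ::
  "(real ^ 'n ^ 'g \<Rightarrow> real) \<Rightarrow> real ^ 'n ^ 'g \<Rightarrow> real ^ 'n ^ 'g \<Rightarrow> real" where
  "init_step E U D = - (gradG E U \<bullet> D) / (hessG E U D \<bullet> D)"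

definition armijo ::
  "(real ^ 'n ^ 'g \<Rightarrow> real) \<Rightarrow> (real ^ 'n ^ 'g \<Rightarrow> real ^ 'n ^ 'g \<Rightarrow> real \<Rightarrow> real ^ 'n ^ 'g) \<Rightarrow>
   real \<Rightarrow> real ^ 'n ^ 'g \<Rightarrow> real ^ 'n ^ 'g \<Rightarrow> real \<Rightarrow> bool" where
  "armijo E ortho \<eta> U D t \<longleftrightarrow> E (ortho U D t) \<le> E U + \<eta> * t * (gradG E U \<bullet> D)"

definition newton_step ::
  "(real ^ 'n ^ 'g \<Rightarrow> real) \<Rightarrow> (real ^ 'n ^ 'g \<Rightarrow> real ^ 'n ^ 'g \<Rightarrow> real \<Rightarrow> real ^ 'n ^ 'g) \<Rightarrow>
   real \<Rightarrow> real \<Rightarrow> real \<Rightarrow> real ^ 'n ^ 'g \<Rightarrow> real ^ 'n ^ 'g \<Rightarrow> bool" where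
  "newton_step E ortho q \<eta> s U U' \<longleftrightarrow>
     (\<exists>D\<in>newton_directions E s U. \<exists>m.
        armijo E ortho \<eta> U D (init_step E U D * q ^ m) \<and>
        (\<forall>k<m. \<not> armijo E ortho \<eta> U D (init_step E U D * q ^ k)) \<and>
        U' = ortho U D (init_step E U D * q ^ m))"

text \<open>
  The method does not break down at \<open>U\<close>: a direction exists, and for every direction that may
  be taken, the initial step is defined (no division by zero) and the backtracking terminates.
\<close>

definition newton_step_defined ::
  "(real ^ 'n ^ 'g \<Rightarrow> real) \<Rightarrow> (real ^ 'n ^ 'g \<Rightarrow> real ^ 'n ^ 'g \<Rightarrow> real \<Rightarrow> real ^ 'n ^ 'g) \<Rightarrow>
   real \<Rightarrow> real \<Rightarrow> real \<Rightarrow> real ^ 'n ^ 'g \<Rightarrow> bool" where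
  "newton_step_defined E ortho q \<eta> s U \<longleftrightarrow>
     newton_directions E s U \<noteq> {} \<and>
     (\<forall>D\<in>newton_directions E s U. hessG E U D \<bullet> D \<noteq> 0 \<and>
        (\<exists>m. armijo E ortho \<eta> U D (init_step E U D * q ^ m)))"

text \<open>
  The tolerance \<open>\<sigma>\<^sub>n\<close> may depend on the iterates computed so far, so it is given by a rule
  \<open>\<sigma>\<close> that is applied to the list of \<open>U\<^sub>0, \<dots>, U\<^sub>n\<close>. The predicate says that
  \<open>U\<^sub>0, \<dots>, U\<^sub>n\<close> are produced by \<open>n\<close> steps of the method.
\<close>

definition newton_iterates ::
  "(real ^ 'n ^ 'g \<Rightarrow> real) \<Rightarrow> (real ^ 'n ^ 'g \<Rightarrow> real ^ 'n ^ 'g \<Rightarrow> real \<Rightarrow> real ^ 'n ^ 'g) \<Rightarrow>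
   real \<Rightarrow> real \<Rightarrow> ((real ^ 'n ^ 'g) list \<Rightarrow> real) \<Rightarrow> real ^ 'n ^ 'g \<Rightarrow>
   (nat \<Rightarrow> real ^ 'n ^ 'g) \<Rightarrow> nat \<Rightarrow> bool" where
  "newton_iterates E ortho q \<eta> \<sigma> U0 U n \<longleftrightarrow> U 0 = U0 \<and>
     (\<forall>k<n. norm (gradG E (U k)) \<noteq> 0 \<and>
        newton_step E ortho q \<eta> (\<sigma> (map U [0..<Suc k])) (U k) (U (Suc k)))"

text \<open>
  A full run. The method stops at the first \<open>n\<close> with vanishing gradient; the values of the
  sequence after that index are irrelevant.
\<close>

definition newton_sequence ::
  "(real ^ 'n ^ 'g \<Rightarrow> real) \<Rightarrow> (real ^ 'n ^ 'g \<Rightarrow> real ^ 'n ^ 'g \<Rightarrow> real \<Rightarrow> real ^ 'n ^ 'g) \<Rightarrow>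
   real \<Rightarrow> real \<Rightarrow> ((real ^ 'n ^ 'g) list \<Rightarrow> real) \<Rightarrow> real ^ 'n ^ 'g \<Rightarrow>
   (nat \<Rightarrow> real ^ 'n ^ 'g) \<Rightarrow> bool" where
  "newton_sequence E ortho q \<eta> \<sigma> U0 U \<longleftrightarrow>
     (\<forall>n. (\<forall>k<n. norm (gradG E (U k)) \<noteq> 0) \<longrightarrow> newton_iterates E ortho q \<eta> \<sigma> U0 U n)"

end

theory Submission
  imports Defs
begin

text \<open>
  A constant tolerance works. Let \<open>g = gradG E U\<close> and \<open>H = hessG E U\<close> at a Stiefel point
  \<open>U\<close> whose class is close to that of the minimizer. Differentiating the gradient along
  retraction curves turns the bounds on it into \<open>norm (H D) \<le> (L0 + C0) * norm D\<close> for tangent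
  \<open>D\<close>; together with the coercivity \<open>H D \<bullet> D \<ge> \<nu> * (norm D)\<^sup>2\<close> this shows that
  every Newton direction with residual tolerance \<open>\<nu> / (\<nu> + 4 * (L0 + C0))\<close> is a descent
  direction with \<open>- (g \<bullet> D)\<close> between \<open>3/4\<close> and \<open>5/4\<close> of \<open>H D \<bullet> D\<close>
  (\<open>newton_direction_estimates\<close>). In particular the initial step lies in \<open>[3/4, 5/4]\<close>, and
  \<open>norm D\<close> is comparable to \<open>norm g\<close>.

  The line search needs two uniform facts. The bounds on the retraction
  and the gradient show that the Armijo condition holds below a threshold that does not depend on
  \<open>U\<close> and \<open>D\<close> (\<open>armijo_for_small_steps\<close>), so backtracking terminates with step lengths
  bounded away from zero. And \<open>norm g\<close> is at most a multiple of the distance to the minimizer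
  (\<open>norm_gradG_le_grass_dist\<close>), so steps from the \<open>\<delta>2\<close>-ball remain in the \<open>\<delta>1\<close>-ball,
  where the hypothesis on the level set puts them back into the \<open>\<delta>2\<close>-ball
  (\<open>trial_point_in_basin\<close>). Hence coercivity holds at all iterates.

  Each step therefore lowers the energy by a fixed multiple of \<open>(norm g)\<^sup>2\<close>
  (\<open>newton_step_in_basin\<close>). The energy is bounded below on the compact Stiefel manifold, so
  \<open>norm g\<close> tends to zero.
\<close>

section \<open>Frobenius geometry of the Stiefel manifold\<close>

lemma norm_power2_eq_sum_rows: "(norm (A :: real ^ 'n ^ 'm))\<^sup>2 = (\<Sum>i\<in>UNIV. (norm (A $ i))\<^sup>2)"
  by (simp add: norm_vec_def L2_set_def sum_nonneg)

text \<open>The entries of a product are inner products of rows and columns: Cauchy--Schwarz.\<close>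

lemma norm_matrix_mult_le:
  fixes A :: "real ^ 'k ^ 'm" and B :: "real ^ 'n ^ 'k"
  shows "norm (A ** B) \<le> norm A * norm B"
proof -
  let ?c = "\<lambda>j. transpose B $ j"
  have entry: "(A ** B) $ i $ j = A $ i \<bullet> ?c j" for i j
    by (simp add: matrix_matrix_mult_def inner_vec_def transpose_def)
  have normB: "norm (transpose B) = norm B"
    unfolding norm_eq_sqrt_inner inner_vec_def transpose_def by (subst sum.swap) simp
  have "(norm (A ** B))\<^sup>2 = (\<Sum>i\<in>UNIV. \<Sum>j\<in>UNIV. (A $ i \<bullet> ?c j)\<^sup>2)"
    by (simp add: norm_power2_eq_sum_rows norm_vec_def L2_set_def sum_nonneg entry)
  also have "\<dots> \<le> (\<Sum>i\<in>UNIV. \<Sum>j\<in>UNIV. (norm (A $ i))\<^sup>2 * (norm (?c j))\<^sup>2)"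
    by (intro sum_mono) (metis Cauchy_Schwarz_ineq power2_norm_eq_inner)
  also have "\<dots> = (norm A)\<^sup>2 * (norm (transpose B))\<^sup>2"
    unfolding norm_power2_eq_sum_rows sum_product ..
  finally have "(norm (A ** B))\<^sup>2 \<le> (norm A * norm B)\<^sup>2"
    by (simp add: normB power_mult_distrib)
  then show ?thesis
    by (rule power2_le_imp_le) simp
qed

lemma bilinear_matrix_mult: "bilinear ((**) :: real ^ 'k ^ 'm \<Rightarrow> real ^ 'n ^ 'k \<Rightarrow> real ^ 'n ^ 'm)"
  unfolding bilinear_def
  by (auto intro!: linearI simp: vec_eq_iff matrix_matrix_mult_def sum.distrib sum_distrib_left
      algebra_simps)

lemmas matrix_mult_linear_simps =
  bilinear_ladd[OF bilinear_matrix_mult] bilinear_radd[OF bilinear_matrix_mult]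
  bilinear_lmul[OF bilinear_matrix_mult] bilinear_rmul[OF bilinear_matrix_mult]
  bilinear_lneg[OF bilinear_matrix_mult] bilinear_rneg[OF bilinear_matrix_mult]
  bilinear_lsub[OF bilinear_matrix_mult] bilinear_rsub[OF bilinear_matrix_mult]
  bilinear_lzero[OF bilinear_matrix_mult] bilinear_rzero[OF bilinear_matrix_mult]

lemma inner_matrix_mult_left:
  fixes A :: "real ^ 'k ^ 'm"
  shows "(A ** B) \<bullet> C = B \<bullet> (transpose A ** C)"
  by (simp add: inner_eq_trace matrix_transpose_mul matrix_mul_assoc)

lemma norm_stiefel_mult: "U \<in> stiefel \<Longrightarrow> norm (U ** M) = norm M"
  by (simp add: norm_eq inner_matrix_mult_left matrix_mul_assoc stiefel_def)

lemma norm_stiefel: "U \<in> (stiefel :: (real ^ 'n ^ 'g) set) \<Longrightarrow> norm U = sqrt (real CARD('n))"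
  by (simp add: stiefel_def norm_eq_sqrt_inner inner_eq_trace trace_I)

lemma compact_stiefel: "compact (stiefel :: (real ^ 'n ^ 'g) set)"
proof -
  have "bounded (stiefel :: (real ^ 'n ^ 'g) set)"
    unfolding bounded_iff using norm_stiefel by (metis order_refl)
  moreover have "closed (stiefel :: (real ^ 'n ^ 'g) set)"
    unfolding stiefel_def matrix_matrix_mult_def transpose_def
    by (intro closed_Collect_eq continuous_intros)
  ultimately show ?thesis
    by (simp add: compact_eq_bounded_closed)
qed

text \<open>
  For \<open>U\<close> on the Stiefel manifold, \<open>\<lambda>X. (mat 1 - U ** transpose U) ** X\<close> is the orthogonal
  projection onto \<open>tangent U\<close>.
\<close>

definition tangent_proj :: "real ^ 'n ^ 'g \<Rightarrow> real ^ 'n ^ 'g \<Rightarrow> real ^ 'n ^ 'g" where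
  "tangent_proj U X = (mat 1 - U ** transpose U) ** X"

lemma tangent_proj_eq: "tangent_proj U X = X - U ** (transpose U ** X)"
  by (simp add: tangent_proj_def matrix_mult_linear_simps matrix_mul_assoc)

lemma linear_tangent_proj: "linear (tangent_proj U)"
  by (rule linearI) (simp_all add: tangent_proj_def matrix_mult_linear_simps)

lemma tangent_iff: "D \<in> tangent U \<longleftrightarrow> transpose U ** D = 0"
proof -
  have "transpose D ** U = 0 \<longleftrightarrow> transpose (transpose D ** U) = 0"
    by (metis transpose_transpose transpose_mat mat_0)
  then show ?thesis
    by (simp add: tangent_def matrix_transpose_mul)
qed

lemma tangent_proj_in_tangent: "U \<in> stiefel \<Longrightarrow> tangent_proj U X \<in> tangent U"
  by (simp add: tangent_iff tangent_proj_eq matrix_mult_linear_simps matrix_mul_assoc stiefel_def)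

lemma tangent_proj_id: "D \<in> tangent U \<Longrightarrow> tangent_proj U D = D"
  by (simp add: tangent_iff tangent_proj_eq matrix_mult_linear_simps)

lemma tangent_proj_inner: "D \<in> tangent U \<Longrightarrow> tangent_proj U X \<bullet> D = X \<bullet> D"
  by (simp add: tangent_iff tangent_proj_eq inner_diff_left inner_matrix_mult_left)

lemma norm_tangent_proj_le:
  assumes "U \<in> stiefel"
  shows "norm (tangent_proj U X) \<le> norm X"
proof -
  have "(norm (tangent_proj U X))\<^sup>2 = X \<bullet> tangent_proj U X"
    using tangent_proj_inner[OF tangent_proj_in_tangent[OF assms]]
    by (simp add: power2_norm_eq_inner)
  also have "\<dots> \<le> norm X * norm (tangent_proj U X)"
    by (rule norm_cauchy_schwarz)
  finally show ?thesis
    by (cases "norm (tangent_proj U X) = 0") (auto simp: power2_eq_square)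
qed

lemma norm_transpose_stiefel_mult_le:
  assumes "U \<in> stiefel"
  shows "norm (transpose U ** X) \<le> norm X"
proof -
  have "(norm (transpose U ** X))\<^sup>2 = X \<bullet> (U ** (transpose U ** X))"
    by (metis inner_matrix_mult_left power2_norm_eq_inner transpose_transpose)
  also have "\<dots> \<le> norm X * norm (U ** (transpose U ** X))"
    by (rule norm_cauchy_schwarz)
  also have "\<dots> = norm X * norm (transpose U ** X)"
    by (simp add: norm_stiefel_mult assms)
  finally show ?thesis
    by (cases "norm (transpose U ** X) = 0") (auto simp: power2_eq_square)
qed

lemma subspace_tangent: "subspace (tangent U)"
  by (simp add: subspace_def tangent_iff matrix_mult_linear_simps)

lemma gclass_mult_orthogonal:
  assumes "orthogonal_matrix P"
  shows "gclass (U ** P) = gclass U"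
proof -
  have "gclass (U ** P) \<subseteq> gclass U" if "orthogonal_matrix P" for U :: "real ^ 'n ^ 'g" and P
    using that by (auto simp: gclass_def matrix_mul_assoc[symmetric] intro: orthogonal_matrix_mul)
  from this[OF assms] this[of "transpose P" "U ** P"] assms show ?thesis
    by (auto simp: matrix_mul_assoc[symmetric] orthogonal_matrix_def)
qed

lemma stiefel_mult_orthogonal: "U \<in> stiefel \<Longrightarrow> orthogonal_matrix P \<Longrightarrow> U ** P \<in> stiefel"
  by (simp add: stiefel_def orthogonal_matrix_def matrix_transpose_mul matrix_mul_assoc)
     (metis matrix_mul_assoc matrix_mul_lid)

lemma gclass_in_grass_ball_iff:
  assumes "V \<in> stiefel"
  shows "gclass V \<in> grass_ball U \<delta> \<longleftrightarrow> grass_dist V U \<le> \<delta>"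
  unfolding grass_ball_def mem_Collect_eq using assms grass_dist_gclass_cong by metis

lemma gclass_in_level_set_iff:
  assumes "V \<in> stiefel" and "\<And>U P. orthogonal_matrix P \<Longrightarrow> E (U ** P) = E U"
  shows "gclass V \<in> level_set E E0 \<longleftrightarrow> E V \<le> E0"
  unfolding level_set_def mem_Collect_eq using assms gclass_eqD by metis

lemma grass_dist_le_norm: "grass_dist U V \<le> norm (U - V)"
  using grass_dist_attained[of U V] orthogonal_matrix_id by (metis matrix_mul_rid)

lemma grass_dist_le_add: "grass_dist V U \<le> norm (V - W) + grass_dist W U"
proof -
  obtain P where P: "orthogonal_matrix P" "grass_dist W U = norm (W - U ** P)"
    using grass_dist_attained by blast
  have "grass_dist V U \<le> norm (V - U ** P)"
    using grass_dist_attained[of V U] P(1) by metis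
  also have "\<dots> \<le> norm (V - W) + norm (W - U ** P)"
    using norm_triangle_ineq[of "V - W" "W - U ** P"] by simp
  finally show ?thesis
    by (simp add: P(2))
qed

section \<open>Differential calculus\<close>

text \<open>
  The coordinate formula makes the gradient a finite combination of directional derivatives, whose
  regularity is what \<open>Ck_on\<close> controls.
\<close>

lemma GDERIV_grad:
  assumes "E differentiable (at x)"
  shows "GDERIV E x :> grad E x"
    and "grad E x = (\<Sum>b\<in>Basis. frechet_derivative E (at x) b *\<^sub>R b)"
proof -
  let ?G = "\<Sum>b\<in>Basis. frechet_derivative E (at x) b *\<^sub>R b"
  have lin: "linear (frechet_derivative E (at x))"
    using assms by (rule linear_frechet_derivative)
  have "frechet_derivative E (at x) h = h \<bullet> ?G" for h
  proof -
    have "frechet_derivative E (at x) h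
        = frechet_derivative E (at x) (\<Sum>b\<in>Basis. (h \<bullet> b) *\<^sub>R b)"
      by (simp add: euclidean_representation)
    also have "\<dots> = h \<bullet> ?G"
      by (simp add: linear_sum[OF lin] linear_scale[OF lin] inner_sum_right mult.commute)
    finally show ?thesis .
  qed
  then have G: "GDERIV E x :> ?G"
    unfolding gderiv_def using assms
    by (metis (no_types, lifting) ext frechet_derivative_works)
  have unique: "G = ?G" if "GDERIV E x :> G" for G
  proof -
    have "(\<lambda>h. h \<bullet> G) = (\<lambda>h. h \<bullet> ?G)"
      using that G unfolding gderiv_def by (rule has_derivative_unique)
    then show ?thesis
      by (simp only: fun_eq_iff vector_eq_ldot)
  qed
  show "grad E x = ?G"
    unfolding grad_def using G unique by (rule the_equality)
  with G show "GDERIV E x :> grad E x" by simp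
qed

lemma Ck_on_imp_differentiable:
  assumes "Ck_on (Suc k) f S" "open S" "x \<in> S"
  shows "f differentiable (at x)"
  using assms by (simp add: differentiable_on_eq_differentiable_at)

lemma Ck_on_imp_grad_differentiable:
  assumes "Ck_on (Suc (Suc k)) E S" "open S" "x \<in> S"
  shows "grad E differentiable (at x)"
proof -
  have "(\<lambda>y. \<Sum>b\<in>Basis. frechet_derivative E (at y) b *\<^sub>R b) differentiable (at x)"
    using assms by (auto intro!: differentiable_sum differentiable_scaleR
        simp: differentiable_on_eq_differentiable_at)
  then obtain G' where "((\<lambda>y. \<Sum>b\<in>Basis. frechet_derivative E (at y) b *\<^sub>R b) has_derivative G') (at x)"
    unfolding differentiable_def by blast
  then have "(grad E has_derivative G') (at x)"
    using assms(2,3)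
    by (rule has_derivative_transform_within_open)
       (metis GDERIV_grad(2) Ck_on_imp_differentiable[OF assms(1,2)])
  then show ?thesis
    unfolding differentiable_def by blast
qed

lemma has_vector_derivative_imp_quotient_tendsto:
  assumes "(f has_vector_derivative f') (at a)"
  shows "((\<lambda>h. (f (a + h) - f a) /\<^sub>R h) \<longlongrightarrow> f') (at 0)"
proof -
  have "((\<lambda>h. norm (f (a + h) - f a - h *\<^sub>R f') / norm h) \<longlongrightarrow> 0) (at 0)"
    using assms unfolding has_vector_derivative_def has_derivative_at by blast
  moreover have "norm (f (a + h) - f a - h *\<^sub>R f') / norm h = norm ((f (a + h) - f a) /\<^sub>R h - f')"
    if "h \<noteq> 0" for h
  proof -
    have "(f (a + h) - f a) /\<^sub>R h - f' = (f (a + h) - f a - h *\<^sub>R f') /\<^sub>R h"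
      using that by (simp add: scaleR_diff_right)
    then show ?thesis
      by (simp add: divide_inverse mult.commute)
  qed
  then have "\<forall>\<^sub>F h in at 0. norm (f (a + h) - f a - h *\<^sub>R f') / norm h
      = norm ((f (a + h) - f a) /\<^sub>R h - f')"
    by (simp add: eventually_at_filter)
  ultimately have "((\<lambda>h. norm ((f (a + h) - f a) /\<^sub>R h - f')) \<longlongrightarrow> 0) (at 0)"
    by (rule Lim_transform_eventually)
  then show ?thesis
    using Lim_null tendsto_norm_zero_iff by blast
qed

text \<open>
  A curve that moves at most \<open>K\<close> times as far as another one from the same time is at most
  \<open>K\<close> times as fast. It serves to read off a Hessian bound from a Lipschitz bound that is
  known along curves in the manifold only.
\<close>

lemma norm_vector_derivative_le_of_dominated:
  assumes "(f has_vector_derivative f') (at a)" "(g has_vector_derivative g') (at a)"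
    and "\<And>t. norm (f t - f a) \<le> K * norm (g t - g a)"
  shows "norm f' \<le> K * norm g'"
proof (rule tendsto_le)
  show "((\<lambda>h. K * norm ((g (a + h) - g a) /\<^sub>R h)) \<longlongrightarrow> K * norm g') (at 0)"
    by (intro tendsto_intros has_vector_derivative_imp_quotient_tendsto assms)
  show "((\<lambda>h. norm ((f (a + h) - f a) /\<^sub>R h)) \<longlongrightarrow> norm f') (at 0)"
    by (intro tendsto_intros has_vector_derivative_imp_quotient_tendsto assms)
  show "\<forall>\<^sub>F h in at 0. norm ((f (a + h) - f a) /\<^sub>R h) \<le> K * norm ((g (a + h) - g a) /\<^sub>R h)"
  proof (intro always_eventually allI)
    fix h
    have "inverse \<bar>h\<bar> * norm (f (a + h) - f a) \<le> inverse \<bar>h\<bar> * (K * norm (g (a + h) - g a))"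
      using assms(3) by (rule mult_left_mono) simp
    then show "norm ((f (a + h) - f a) /\<^sub>R h) \<le> K * norm ((g (a + h) - g a) /\<^sub>R h)"
      by (simp add: mult.left_commute)
  qed
qed simp

text \<open>
  A curve that stays in the subset sees no difference between a map and its local smooth
  extension, so the chain rule applies to the extension.
\<close>

lemma differentiable_curve_of_smooth_on_subset:
  assumes "smooth_on_subset F A" and "\<And>t. c t \<in> A" and "c differentiable (at t)"
  shows "(\<lambda>s. F (c s)) differentiable (at t)"
proof -
  obtain T h where T: "open T" "c t \<in> T" "\<forall>k. Ck_on k h T" "\<forall>y\<in>A \<inter> T. h y = F y"
    using assms(1) assms(2)[of t] unfolding smooth_on_subset_def by meson
  have "h differentiable (at (c t))"
    using T(1-3) by (blast intro: Ck_on_imp_differentiable[of 0])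
  then have "(\<lambda>s. h (c s)) differentiable (at t)"
    using differentiable_chain_at[OF assms(3)] by (simp add: o_def)
  then obtain h' where h': "((\<lambda>s. h (c s)) has_derivative h') (at t)"
    unfolding differentiable_def by blast
  have "\<forall>\<^sub>F s in at t. c s \<in> T"
    using differentiable_imp_continuous_within[OF assms(3)] T(1,2)
    unfolding continuous_at by (rule topological_tendstoD)
  have "((\<lambda>s. F (c s)) has_derivative h') (at t)"
  proof (rule has_derivative_transform_eventually[OF h'])
    show "h (c t) = F (c t)" "t \<in> UNIV"
      using T(2,4) assms(2)[of t] by simp_all
    show "\<forall>\<^sub>F s in at t. h (c s) = F (c s)"
      using \<open>\<forall>\<^sub>F s in at t. c s \<in> T\<close> by eventually_elim (use T(4) assms(2) in simp)
  qed
  then show ?thesis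
    unfolding differentiable_def by blast
qed

section \<open>Energies and retractions on the Stiefel manifold\<close>

locale stiefel_energy =
  fixes E :: "real ^ 'n ^ 'g \<Rightarrow> real"
    and ortho :: "real ^ 'n ^ 'g \<Rightarrow> real ^ 'n ^ 'g \<Rightarrow> real \<Rightarrow> real ^ 'n ^ 'g"
    and L0 C0 C1 :: real
  assumes L0_pos: "L0 > 0" and C0_pos: "C0 > 0" and C1_pos: "C1 > 0"
    and E_mult_orthogonal: "orthogonal_matrix P \<Longrightarrow> E (U ** P) = E U"
    and E_gderiv: "U \<in> stiefel \<Longrightarrow> GDERIV E U :> grad E U"
    and grad_differentiable: "U \<in> stiefel \<Longrightarrow> grad E differentiable (at U)"
    and grad_lipschitz:
      "U \<in> stiefel \<Longrightarrow> V \<in> stiefel \<Longrightarrow> norm (grad E U - grad E V) \<le> L0 * norm (U - V)"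
    and grad_bound: "U \<in> stiefel \<Longrightarrow> norm (grad E U) \<le> C0"
    and ortho_stiefel: "U \<in> stiefel \<Longrightarrow> D \<in> tangent U \<Longrightarrow> ortho U D t \<in> stiefel"
    and ortho_differentiable:
      "U \<in> stiefel \<Longrightarrow> D \<in> tangent U \<Longrightarrow> (\<lambda>t. ortho U D t) differentiable (at t)"
    and ortho_0: "U \<in> stiefel \<Longrightarrow> D \<in> tangent U \<Longrightarrow> ortho U D 0 = U"
    and ortho_deriv_0:
      "U \<in> stiefel \<Longrightarrow> D \<in> tangent U \<Longrightarrow> ((\<lambda>t. ortho U D t) has_vector_derivative D) (at 0)"
    and ortho_dist:
      "U \<in> stiefel \<Longrightarrow> D \<in> tangent U \<Longrightarrow> t \<ge> 0 \<Longrightarrow> norm (ortho U D t - U) \<le> C1 * t * norm D"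
    and ortho_deriv_dist:
      "U \<in> stiefel \<Longrightarrow> D \<in> tangent U \<Longrightarrow> t \<ge> 0 \<Longrightarrow>
         norm (vector_derivative (\<lambda>s. ortho U D s) (at t) - D) \<le> C1 * t * (norm D)\<^sup>2"
begin

lemma gradG_eq: "gradG E U = tangent_proj U (grad E U)"
  by (simp add: gradG_def tangent_proj_def)

lemma gradG_inner: "D \<in> tangent U \<Longrightarrow> gradG E U \<bullet> D = grad E U \<bullet> D"
  by (simp add: gradG_eq tangent_proj_inner)

lemma hessG_eq: "hessG E U D = tangent_proj U (hess E U D) - D ** (transpose U ** grad E U)"
  by (simp add: hessG_def tangent_proj_def)

lemma gradG_in_tangent: "U \<in> stiefel \<Longrightarrow> gradG E U \<in> tangent U"
  by (simp add: gradG_eq tangent_proj_in_tangent)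

lemma hessG_in_tangent:
  assumes "U \<in> stiefel" "D \<in> tangent U"
  shows "hessG E U D \<in> tangent U"
  unfolding hessG_eq
proof (rule subspace_diff[OF subspace_tangent tangent_proj_in_tangent[OF assms(1)]])
  show "D ** (transpose U ** grad E U) \<in> tangent U"
    using assms(2) by (simp add: tangent_iff matrix_mul_assoc matrix_mult_linear_simps)
qed

lemma linear_hessG:
  assumes "U \<in> stiefel"
  shows "linear (hessG E U)"
proof -
  have "linear (hess E U)"
    unfolding hess_def using linear_frechet_derivative[OF grad_differentiable[OF assms]] .
  then show ?thesis
    by (intro linearI)
       (simp_all add: hessG_eq linear_add linear_scale linear_tangent_proj matrix_mult_linear_simps
         scaleR_diff_right)
qed

lemma E_along_ortho:
  assumes "U \<in> stiefel" "D \<in> tangent U"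
  shows "((\<lambda>s. E (ortho U D s)) has_real_derivative
           grad E (ortho U D t) \<bullet> vector_derivative (\<lambda>s. ortho U D s) (at t)) (at t)"
proof -
  let ?v = "vector_derivative (\<lambda>s. ortho U D s) (at t)"
  have "((\<lambda>s. ortho U D s) has_vector_derivative ?v) (at t)"
    using ortho_differentiable[OF assms] vector_derivative_works by blast
  moreover have "(E has_derivative (\<lambda>h. h \<bullet> grad E (ortho U D t))) (at (ortho U D t))"
    using E_gderiv[OF ortho_stiefel[OF assms]] by (simp add: gderiv_def)
  ultimately have "((E \<circ> (\<lambda>s. ortho U D s)) has_derivative
      (\<lambda>h. h \<bullet> grad E (ortho U D t)) \<circ> (\<lambda>h. h *\<^sub>R ?v)) (at t)"
    unfolding has_vector_derivative_def by (rule diff_chain_at)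
  moreover have "(\<lambda>h. h \<bullet> grad E (ortho U D t)) \<circ> (\<lambda>h. h *\<^sub>R ?v) = (*) (grad E (ortho U D t) \<bullet> ?v)"
    by (auto simp: inner_commute mult.commute)
  ultimately show ?thesis
    by (simp add: has_field_derivative_def o_def)
qed

text \<open>
  The Hessian in a tangent direction is the velocity of the gradient along a curve in the Stiefel
  manifold, so the Lipschitz constant of the gradient on the manifold bounds it, although the
  ambient Hessian may be larger in normal directions.
\<close>

lemma norm_hess_le:
  assumes "U \<in> stiefel" "D \<in> tangent U"
  shows "norm (hess E U D) \<le> L0 * norm D"
proof (rule norm_vector_derivative_le_of_dominated)
  show "((\<lambda>t. ortho U D t) has_vector_derivative D) (at 0)"
    using ortho_deriv_0[OF assms] .
  have "(grad E has_derivative hess E U) (at (ortho U D 0))"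
    unfolding hess_def ortho_0[OF assms]
    using grad_differentiable[OF assms(1)] by (metis eta_contract_eq frechet_derivative_works)
  then have "((grad E \<circ> (\<lambda>t. ortho U D t)) has_derivative hess E U \<circ> (\<lambda>h. h *\<^sub>R D)) (at 0)"
    using ortho_deriv_0[OF assms] unfolding has_vector_derivative_def by (intro diff_chain_at)
  moreover have "linear (hess E U)"
    unfolding hess_def using linear_frechet_derivative[OF grad_differentiable[OF assms(1)]] .
  ultimately show "((\<lambda>t. grad E (ortho U D t)) has_vector_derivative hess E U D) (at 0)"
    by (simp add: has_vector_derivative_def o_def linear_scale)
  show "norm (grad E (ortho U D t) - grad E (ortho U D 0)) \<le> L0 * norm (ortho U D t - ortho U D 0)"
    for t
    using grad_lipschitz ortho_stiefel[OF assms] by blast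
qed

lemma norm_hessG_le:
  assumes "U \<in> stiefel" "D \<in> tangent U"
  shows "norm (hessG E U D) \<le> (L0 + C0) * norm D"
proof -
  have "norm (tangent_proj U (hess E U D)) \<le> L0 * norm D"
    using norm_tangent_proj_le[OF assms(1)] norm_hess_le[OF assms] by (rule order_trans)
  moreover have "norm (D ** (transpose U ** grad E U)) \<le> norm D * C0"
  proof -
    have "norm (D ** (transpose U ** grad E U)) \<le> norm D * norm (transpose U ** grad E U)"
      by (rule norm_matrix_mult_le)
    also have "\<dots> \<le> norm D * C0"
      using order_trans[OF norm_transpose_stiefel_mult_le[OF assms(1)] grad_bound[OF assms(1)]]
      by (rule mult_left_mono) simp
    finally show ?thesis .
  qed
  ultimately show ?thesis
    unfolding hessG_eq
    using norm_triangle_ineq4[of "tangent_proj U (hess E U D)" "D ** (transpose U ** grad E U)"]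
    by (simp add: algebra_simps)
qed

text \<open>
  A retraction curve through a minimizer, started in the direction of steepest descent, cannot
  lower the energy; it may be followed for negative times too, so its slope vanishes.
\<close>

lemma gradG_local_minimizer:
  assumes "grass_local_minimizer E V"
  shows "gradG E V = 0"
proof -
  define D where "D = gradG E V"
  from assms obtain r where V: "V \<in> stiefel" and r: "r > 0"
    and min: "\<And>W. W \<in> stiefel \<Longrightarrow> gclass W \<in> grass_ball V r \<Longrightarrow> E V \<le> E W"
    unfolding grass_local_minimizer_def by blast
  have D: "D \<in> tangent V"
    unfolding D_def using gradG_in_tangent[OF V] .
  have "isCont (\<lambda>t. ortho V D t) 0"
    using differentiable_imp_continuous_within[OF ortho_differentiable[OF V D]] .
  then obtain d where d: "d > 0" "\<And>t. \<bar>t\<bar> < d \<Longrightarrow> norm (ortho V D t - V) < r"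
    using r unfolding continuous_at_eps_delta dist_norm ortho_0[OF V D] by (metis diff_zero real_norm_def)
  have "vector_derivative (\<lambda>s. ortho V D s) (at 0) = D"
    using ortho_deriv_0[OF V D] by (rule vector_derivative_at)
  then have "((\<lambda>s. E (ortho V D s)) has_real_derivative gradG E V \<bullet> D) (at 0)"
    using E_along_ortho[OF V D, of 0] by (simp add: ortho_0[OF V D] gradG_inner[OF D])
  then have "gradG E V \<bullet> D = 0"
  proof (rule DERIV_local_min[OF _ d(1)])
    show "\<forall>t. \<bar>0 - t\<bar> < d \<longrightarrow> E (ortho V D 0) \<le> E (ortho V D t)"
    proof (intro allI impI)
      fix t assume "\<bar>0 - t\<bar> < d"
      then have "grass_dist (ortho V D t) V \<le> r"
        using d(2)[of t] grass_dist_le_norm[of "ortho V D t" V] by simp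
      then show "E (ortho V D 0) \<le> E (ortho V D t)"
        using min ortho_stiefel[OF V D] by (simp add: ortho_0[OF V D] gclass_in_grass_ball_iff)
    qed
  qed
  then show ?thesis
    by (simp add: D_def)
qed

lemma grass_local_minimizer_mult_orthogonal:
  assumes "grass_local_minimizer E V" "orthogonal_matrix P"
  shows "grass_local_minimizer E (V ** P)"
proof -
  have "gclass W \<in> grass_ball (V ** P) r \<longleftrightarrow> gclass W \<in> grass_ball V r" if "W \<in> stiefel" for W r
    using that grass_dist_gclass_cong[OF refl gclass_mult_orthogonal[OF assms(2)], of W V]
    by (simp add: gclass_in_grass_ball_iff)
  moreover have "V ** P \<in> stiefel"
    using assms by (simp add: grass_local_minimizer_def stiefel_mult_orthogonal)
  ultimately show ?thesis
    using assms(1) by (simp add: grass_local_minimizer_def E_mult_orthogonal[OF assms(2)])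
qed

text \<open>
  Near the representative \<open>V = Ustar ** P\<close> closest to \<open>U\<close>, split
  \<open>grad E U = (grad E U - grad E V) + grad E V\<close>. The first part is Lipschitz; the second one is
  normal at \<open>V\<close>, that is, of the form \<open>V ** S\<close>, and projecting it at \<open>U\<close> only sees
  \<open>(V - U) ** S\<close>.
\<close>

lemma norm_gradG_le_grass_dist:
  assumes "grass_local_minimizer E Ustar" and U: "U \<in> stiefel"
  shows "norm (gradG E U) \<le> (L0 + C0) * grass_dist U Ustar"
proof -
  obtain P where P: "orthogonal_matrix P" "grass_dist U Ustar = norm (U - Ustar ** P)"
    using grass_dist_attained by blast
  define V where "V = Ustar ** P"
  have minV: "grass_local_minimizer E V"
    unfolding V_def using assms(1) P(1) by (rule grass_local_minimizer_mult_orthogonal)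
  then have V: "V \<in> stiefel"
    by (simp add: grass_local_minimizer_def)
  define S where "S = transpose V ** grad E V"
  have "grad E V = V ** S"
    using gradG_local_minimizer[OF minV] by (simp add: gradG_eq tangent_proj_eq S_def)
  moreover have "tangent_proj U (V ** S) = tangent_proj U (V - U) ** S"
    using U by (simp add: tangent_proj_eq matrix_mult_linear_simps matrix_mul_assoc stiefel_def)
  ultimately have "gradG E U = tangent_proj U (grad E U - grad E V) + tangent_proj U (V - U) ** S"
    by (simp add: gradG_eq linear_diff[OF linear_tangent_proj])
  moreover have "norm (tangent_proj U (grad E U - grad E V)) \<le> L0 * norm (U - V)"
    using norm_tangent_proj_le[OF U] grad_lipschitz[OF U V] by (rule order_trans)
  moreover have "norm (tangent_proj U (V - U) ** S) \<le> norm (U - V) * C0"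
  proof -
    have "norm (tangent_proj U (V - U) ** S) \<le> norm (tangent_proj U (V - U)) * norm S"
      by (rule norm_matrix_mult_le)
    also have "\<dots> \<le> norm (U - V) * C0"
    proof (rule mult_mono)
      show "norm (tangent_proj U (V - U)) \<le> norm (U - V)"
        using norm_tangent_proj_le[OF U] by (metis norm_minus_commute)
      show "norm S \<le> C0"
        unfolding S_def
        using norm_transpose_stiefel_mult_le[OF V] grad_bound[OF V] by (rule order_trans)
    qed auto
    finally show ?thesis .
  qed
  ultimately have "norm (gradG E U) \<le> L0 * norm (U - V) + norm (U - V) * C0"
    using norm_triangle_mono by metis
  then show ?thesis
    by (simp add: P(2) V_def algebra_simps)
qed

lemma E_bounded_below: "\<exists>b. \<forall>U\<in>stiefel. b \<le> E U"
proof -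
  have "continuous_on stiefel E"
    using E_gderiv has_derivative_continuous unfolding gderiv_def
    by (metis continuous_at_imp_continuous_on)
  then have "compact (E ` stiefel)"
    using compact_stiefel by (rule compact_continuous_image)
  then show ?thesis
    by (meson bounded_imp_bdd_below bdd_below.unfold compact_imp_bounded image_eqI)
qed

section \<open>A single Newton step at a point with coercive Hessian\<close>

text \<open>
  A coercive Hessian is invertible on the tangent space. Adding the projection onto the normal
  space turns it into an injective endomorphism of the whole matrix space, which is therefore
  surjective.
\<close>

lemma newton_direction_exists:
  assumes U: "U \<in> stiefel" and "\<nu> > 0" and "0 \<le> s"
    and coercive: "\<And>D. D \<in> tangent U \<Longrightarrow> hessG E U D \<bullet> D \<ge> \<nu> * (norm D)\<^sup>2"
  shows "newton_directions E s U \<noteq> {}"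
proof -
  let ?p = "tangent_proj U"
  define F where "F X = hessG E U (?p X) + (X - ?p X)" for X
  have T: "?p X \<in> tangent U" for X
    using tangent_proj_in_tangent[OF U] .
  have linp: "linear ?p" and linH: "linear (hessG E U)"
    by (rule linear_tangent_proj) (rule linear_hessG[OF U])
  have linF: "linear F"
    unfolding F_def
    by (intro linear_compose_add linear_compose_sub linear_compose[OF linp linH, unfolded o_def]
        linp linear_id[unfolded id_def])
  have pF: "?p (F X) = hessG E U (?p X)" for X
    unfolding F_def linear_add[OF linp] linear_diff[OF linp]
    by (simp add: tangent_proj_id T hessG_in_tangent[OF U])
  have "inj F"
    unfolding linear_injective_0[OF linF]
  proof (intro allI impI)
    fix X assume "F X = 0"
    then have H0: "hessG E U (?p X) = 0"
      using pF[of X] linear_0[OF linp] by simp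
    then have "\<nu> * (norm (?p X))\<^sup>2 \<le> 0"
      using coercive[OF T[of X]] by simp
    then have "?p X = 0"
      using \<open>\<nu> > 0\<close> by (simp add: mult_le_0_iff)
    then show "X = 0"
      using \<open>F X = 0\<close> H0 by (simp add: F_def)
  qed
  then have "surj F"
    using linF linear_injective_imp_surjective by blast
  then obtain X where "F X = - gradG E U"
    by (metis surjD)
  then have "hessG E U (?p X) = - gradG E U"
    using pF[of X] gradG_in_tangent[OF U]
    by (simp add: linear_neg[OF linp] tangent_proj_id)
  then have "?p X \<in> newton_directions E s U"
    using T \<open>0 \<le> s\<close> by (simp add: newton_directions_def)
  then show ?thesis by blast
qed

text \<open>
  Since \<open>norm (gradG E U)\<close> is comparable to \<open>norm D\<close>, a tolerance of at most \<open>\<nu> / (\<nu> + 4 * (L0 + C0))\<close>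
  makes the residual contribute at most a quarter of the curvature \<open>hessG E U D \<bullet> D\<close>.
\<close>

lemma newton_direction_estimates:
  assumes U: "U \<in> stiefel" and "\<nu> > 0" and "0 \<le> s" and s: "s * (\<nu> + 4 * (L0 + C0)) \<le> \<nu>"
    and coercive: "\<And>D. D \<in> tangent U \<Longrightarrow> hessG E U D \<bullet> D \<ge> \<nu> * (norm D)\<^sup>2"
    and D: "D \<in> newton_directions E s U"
  shows "3/4 * (hessG E U D \<bullet> D) \<le> - (gradG E U \<bullet> D)"
    and "- (gradG E U \<bullet> D) \<le> 5/4 * (hessG E U D \<bullet> D)"
    and "norm (gradG E U) \<le> (L0 + C0 + \<nu>) * norm D"
    and "\<nu> * norm D \<le> 2 * norm (gradG E U)"
proof -
  let ?H = "L0 + C0" and ?g = "norm (gradG E U)" and ?d = "norm D"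
  let ?r = "hessG E U D + gradG E U"
  have H: "?H > 0"
    using L0_pos C0_pos by simp
  have "s < 1"
  proof (rule ccontr)
    assume "\<not> s < 1"
    then have "1 * (\<nu> + 4 * ?H) \<le> s * (\<nu> + 4 * ?H)"
      using H \<open>\<nu> > 0\<close> by (intro mult_right_mono) auto
    then have "\<nu> + 4 * ?H \<le> \<nu>"
      using s by simp
    then have "?H \<le> 0"
      by simp
    then show False
      using H by simp
  qed
  have DT: "D \<in> tangent U" and r: "norm ?r \<le> s * ?g"
    using D by (auto simp: newton_directions_def)
  have "?g \<le> norm ?r + norm (hessG E U D)"
    using norm_triangle_ineq4[of ?r "hessG E U D"] by simp
  then have g: "?g \<le> s * ?g + ?H * ?d"
    using r norm_hessG_le[OF U DT] by linarith
  have sg: "4 * (s * ?g) \<le> \<nu> * ?d"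
  proof -
    have "(1 - s) * (4 * (s * ?g)) = 4 * s * (?g - s * ?g)"
      by (simp add: algebra_simps)
    also have "\<dots> \<le> 4 * s * (?H * ?d)"
      using g \<open>0 \<le> s\<close> by (intro mult_left_mono) auto
    also have "\<dots> = (s * (\<nu> + 4 * ?H) - s * \<nu>) * ?d"
      by (simp add: algebra_simps)
    also have "\<dots> \<le> (\<nu> - s * \<nu>) * ?d"
      using s by (intro mult_right_mono) auto
    also have "\<dots> = (1 - s) * (\<nu> * ?d)"
      by (simp add: algebra_simps)
    finally show ?thesis
      using \<open>s < 1\<close> by simp
  qed
  have "\<bar>?r \<bullet> D\<bar> \<le> norm ?r * ?d"
    by (rule Cauchy_Schwarz_ineq2)
  also have "\<dots> \<le> (\<nu> * ?d / 4) * ?d"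
    using r sg by (intro mult_right_mono) auto
  also have "\<dots> = \<nu> * ?d\<^sup>2 / 4"
    by (simp add: power2_eq_square)
  also have "\<dots> \<le> (hessG E U D \<bullet> D) / 4"
    using coercive[OF DT] by simp
  finally have "\<bar>hessG E U D \<bullet> D + gradG E U \<bullet> D\<bar> \<le> (hessG E U D \<bullet> D) / 4"
    by (simp add: inner_add_left)
  then show "3/4 * (hessG E U D \<bullet> D) \<le> - (gradG E U \<bullet> D)"
    and "- (gradG E U \<bullet> D) \<le> 5/4 * (hessG E U D \<bullet> D)"
    by linarith+
  have "0 \<le> \<nu> * ?d"
    using \<open>\<nu> > 0\<close> by simp
  with g sg show "?g \<le> (?H + \<nu>) * ?d"
    by (simp add: algebra_simps)
  have "(\<nu> * ?d) * ?d \<le> norm (hessG E U D) * ?d"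
    using coercive[OF DT] norm_cauchy_schwarz[of "hessG E U D" D]
    by (simp add: power2_eq_square mult.assoc)
  then have "\<nu> * ?d \<le> norm (hessG E U D)"
    by (cases "?d = 0") auto
  also have "\<dots> \<le> norm ?r + ?g"
    using norm_triangle_ineq4[of ?r "gradG E U"] by simp
  also have "\<dots> \<le> s * ?g + ?g"
    using r by simp
  also have "\<dots> \<le> 2 * ?g"
    using mult_right_mono[of s 1 ?g] \<open>s < 1\<close> by simp
  finally show "\<nu> * ?d \<le> 2 * ?g" .
qed

text \<open>
  Along the retraction curve the slope of the energy differs from its initial value
  \<open>gradG E U \<bullet> D\<close> by at most \<open>C1 * (C0 + L0) * t * (norm D)\<^sup>2\<close>, because both the velocity
  and the gradient vary at a linear rate. The mean value theorem concludes.
\<close>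

lemma armijo_for_small_steps:
  assumes U: "U \<in> stiefel" and D: "D \<in> tangent U" and t: "0 \<le> t"
    and small: "C1 * (C0 + L0) * t * (norm D)\<^sup>2 \<le> (1 - \<eta>) * - (gradG E U \<bullet> D)"
  shows "armijo E ortho \<eta> U D t"
proof (cases "t = 0")
  case True
  then show ?thesis
    by (simp add: armijo_def ortho_0[OF U D])
next
  case False
  let ?\<phi> = "\<lambda>s. E (ortho U D s)" and ?v = "\<lambda>z. vector_derivative (\<lambda>s. ortho U D s) (at z)"
  have "\<exists>z>0. z < t \<and> ?\<phi> t - ?\<phi> 0 = (t - 0) * (grad E (ortho U D z) \<bullet> ?v z)"
    using False t by (intro MVT2 E_along_ortho[OF U D]) auto
  then obtain z where z: "0 < z" "z < t"
    and mv: "E (ortho U D t) - E U = t * (grad E (ortho U D z) \<bullet> ?v z)"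
    by (auto simp: ortho_0[OF U D])
  let ?G = "grad E (ortho U D z)"
  have oz: "ortho U D z \<in> stiefel"
    using ortho_stiefel[OF U D] .
  have "?G \<bullet> (?v z - D) \<le> C0 * (C1 * z * (norm D)\<^sup>2)"
  proof -
    have "?G \<bullet> (?v z - D) \<le> norm ?G * norm (?v z - D)"
      by (rule norm_cauchy_schwarz)
    also have "\<dots> \<le> C0 * (C1 * z * (norm D)\<^sup>2)"
      using grad_bound[OF oz] ortho_deriv_dist[OF U D, of z] z C0_pos by (intro mult_mono) auto
    finally show ?thesis .
  qed
  moreover have "(?G - grad E U) \<bullet> D \<le> L0 * (C1 * z * norm D) * norm D"
  proof -
    have "norm (?G - grad E U) \<le> L0 * norm (ortho U D z - U)"
      using grad_lipschitz[OF oz U] .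
    also have "\<dots> \<le> L0 * (C1 * z * norm D)"
      using ortho_dist[OF U D, of z] z L0_pos by (intro mult_left_mono) auto
    finally have "norm (?G - grad E U) * norm D \<le> L0 * (C1 * z * norm D) * norm D"
      by (rule mult_right_mono) simp
    with norm_cauchy_schwarz[of "?G - grad E U" D] show ?thesis
      by (rule order_trans)
  qed
  moreover have "?G \<bullet> ?v z = ?G \<bullet> (?v z - D) + (?G - grad E U) \<bullet> D + gradG E U \<bullet> D"
    by (simp add: gradG_inner[OF D] inner_diff_left inner_diff_right)
  moreover have "C0 * (C1 * z * (norm D)\<^sup>2) + L0 * (C1 * z * norm D) * norm D
      = C1 * (C0 + L0) * (norm D)\<^sup>2 * z"
    by (simp add: power2_eq_square algebra_simps)
  moreover have "C1 * (C0 + L0) * (norm D)\<^sup>2 * z \<le> C1 * (C0 + L0) * (norm D)\<^sup>2 * t"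
    using z C0_pos C1_pos L0_pos by (intro mult_left_mono) auto
  moreover have "C1 * (C0 + L0) * (norm D)\<^sup>2 * t \<le> \<eta> * (gradG E U \<bullet> D) - gradG E U \<bullet> D"
    using small by (simp add: left_diff_distrib mult_ac)
  ultimately have "?G \<bullet> ?v z \<le> \<eta> * (gradG E U \<bullet> D)"
    by linarith
  then have "t * (?G \<bullet> ?v z) \<le> t * (\<eta> * (gradG E U \<bullet> D))"
    using t by (simp add: mult_left_mono)
  then show ?thesis
    using mv by (simp add: armijo_def algebra_simps)
qed

end

section \<open>The line search keeps the iterates near the minimizer\<close>

text \<open>The decreases telescope against the lower bound, so they tend to zero.\<close>

lemma tendsto_zero_of_sufficient_decrease:
  fixes e x :: "nat \<Rightarrow> real"
  assumes "\<kappa> > 0" and "\<And>n. b \<le> e n" and decrease: "\<And>n. e (Suc n) \<le> e n - \<kappa> * (x n)\<^sup>2"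
  shows "x \<longlonglongrightarrow> 0"
proof -
  have "e (Suc n) \<le> e n" for n
  proof -
    have "0 \<le> \<kappa> * (x n)\<^sup>2"
      using \<open>\<kappa> > 0\<close> by simp
    with decrease[of n] show ?thesis by linarith
  qed
  then have "decseq e"
    by (rule decseq_SucI)
  then obtain l where l: "e \<longlonglongrightarrow> l"
    using assms(2) decseq_convergent by metis
  have "(\<lambda>n. (e n - e (Suc n)) / \<kappa>) \<longlonglongrightarrow> (l - l) / \<kappa>"
    using l LIMSEQ_Suc[OF l] \<open>\<kappa> > 0\<close> by (intro tendsto_intros) auto
  then have "(\<lambda>n. (e n - e (Suc n)) / \<kappa>) \<longlonglongrightarrow> 0"
    by simp
  moreover have "(x n)\<^sup>2 \<le> (e n - e (Suc n)) / \<kappa>" for n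
    using decrease[of n] \<open>\<kappa> > 0\<close> by (simp add: pos_le_divide_eq mult.commute)
  ultimately have "(\<lambda>n. (x n)\<^sup>2) \<longlonglongrightarrow> 0"
    by (intro real_tendsto_sandwich[of "\<lambda>_. 0" "\<lambda>n. (x n)\<^sup>2" sequentially
          "\<lambda>n. (e n - e (Suc n)) / \<kappa>"] always_eventually allI tendsto_const zero_le_power2)
  from tendsto_real_sqrt[OF this] show ?thesis
    by (simp add: tendsto_rabs_zero_iff)
qed

locale newton_basin = stiefel_energy E ortho L0 C0 C1
  for E :: "real ^ 'n ^ 'g \<Rightarrow> real"
    and ortho :: "real ^ 'n ^ 'g \<Rightarrow> real ^ 'n ^ 'g \<Rightarrow> real \<Rightarrow> real ^ 'n ^ 'g"
    and L0 C0 C1 :: real +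
  fixes Ustar :: "real ^ 'n ^ 'g" and \<delta>1 \<delta>2 \<nu> E0 q \<eta> :: real
  assumes minimizer: "grass_local_minimizer E Ustar"
    and \<nu>_pos: "\<nu> > 0"
    and coercive: "U \<in> stiefel \<Longrightarrow> grass_dist U Ustar \<le> \<delta>1 \<Longrightarrow> D \<in> tangent U \<Longrightarrow>
           hessG E U D \<bullet> D \<ge> \<nu> * (norm D)\<^sup>2"
    and \<delta>2_pos: "\<delta>2 > 0"
    and \<delta>2_le: "\<delta>2 + 3 * C1 / \<nu> * (L0 + C0) * \<delta>2 \<le> \<delta>1"
    and level_set_gap: "U \<in> stiefel \<Longrightarrow> E U \<le> E0 \<Longrightarrow> grass_dist U Ustar \<le> \<delta>1 \<Longrightarrow>
           grass_dist U Ustar \<le> \<delta>2"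
    and q_pos: "0 < q" and q_less_1: "q < 1" and \<eta>_pos: "0 < \<eta>" and \<eta>_less_1: "\<eta> < 1"
begin

text \<open>
  The set that the method never leaves: the level-set assumption makes a step that lowers the
  energy and does not leave the \<open>\<delta>1\<close>-ball return to the \<open>\<delta>2\<close>-ball.
\<close>

definition basin :: "(real ^ 'n ^ 'g) set" where
  "basin = {U \<in> stiefel. E U \<le> E0 \<and> grass_dist U Ustar \<le> \<delta>2}"

definition tolerance :: real where
  "tolerance = \<nu> / (\<nu> + 4 * (L0 + C0))"

text \<open>
  Up to this step length, the possible growth \<open>C1 * (C0 + L0) * t * (norm D)\<^sup>2\<close> of the slope
  is covered by the slack \<open>(1 - \<eta>) * (3/4 * \<nu> * (norm D)\<^sup>2)\<close> that the Armijo condition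
  leaves.
\<close>

definition armijo_threshold :: real where
  "armijo_threshold = 3/4 * \<nu> * (1 - \<eta>) / (C1 * (C0 + L0))"

lemma tolerance_bounds: "0 < tolerance" "tolerance < 1"
  using \<nu>_pos L0_pos C0_pos by (simp_all add: tolerance_def)

lemma tolerance_mult: "tolerance * (\<nu> + 4 * (L0 + C0)) \<le> \<nu>"
  using \<nu>_pos L0_pos C0_pos by (simp add: tolerance_def)

lemma armijo_threshold_pos: "0 < armijo_threshold"
  using \<nu>_pos L0_pos C0_pos C1_pos \<eta>_less_1 by (simp add: armijo_threshold_def)

lemma basin_stiefel: "U \<in> basin \<Longrightarrow> U \<in> stiefel"
  by (simp add: basin_def)

lemma \<delta>2_le_\<delta>1: "\<delta>2 \<le> \<delta>1"
proof -
  have "0 \<le> 3 * C1 / \<nu> * (L0 + C0) * \<delta>2"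
    using C1_pos \<nu>_pos L0_pos C0_pos \<delta>2_pos by simp
  with \<delta>2_le show ?thesis by linarith
qed

lemma basin_coercive:
  "U \<in> basin \<Longrightarrow> D \<in> tangent U \<Longrightarrow> hessG E U D \<bullet> D \<ge> \<nu> * (norm D)\<^sup>2"
  using coercive \<delta>2_le_\<delta>1 by (auto simp: basin_def)

context
  fixes U D :: "real ^ 'n ^ 'g"
  assumes U: "U \<in> basin" and grad_nz: "gradG E U \<noteq> 0"
    and D: "D \<in> newton_directions E tolerance U"
begin

lemma D_tangent: "D \<in> tangent U"
  using D by (simp add: newton_directions_def)

lemma estimates:
  shows "3/4 * (hessG E U D \<bullet> D) \<le> - (gradG E U \<bullet> D)"
    and "- (gradG E U \<bullet> D) \<le> 5/4 * (hessG E U D \<bullet> D)"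
    and "norm (gradG E U) \<le> (L0 + C0 + \<nu>) * norm D"
    and "\<nu> * norm D \<le> 2 * norm (gradG E U)"
  using newton_direction_estimates[OF basin_stiefel[OF U] \<nu>_pos
      less_imp_le[OF tolerance_bounds(1)] tolerance_mult _ D] basin_coercive[OF U]
  by blast+

lemma D_nonzero: "D \<noteq> 0"
  using estimates(3) grad_nz by auto

lemma curvature_pos: "hessG E U D \<bullet> D > 0"
proof -
  have "0 < \<nu> * (norm D)\<^sup>2"
    using \<nu>_pos D_nonzero by simp
  also have "\<dots> \<le> hessG E U D \<bullet> D"
    using basin_coercive[OF U D_tangent] .
  finally show ?thesis .
qed

lemma init_step_bounds: "3/4 \<le> init_step E U D" "init_step E U D \<le> 5/4"
  unfolding init_step_def
   apply (subst pos_le_divide_eq[OF curvature_pos], rule estimates(1))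
  apply (subst pos_divide_le_eq[OF curvature_pos], rule estimates(2))
  done

lemma slope_bound: "3/4 * \<nu> * (norm D)\<^sup>2 \<le> - (gradG E U \<bullet> D)"
  using estimates(1) basin_coercive[OF U D_tangent] by linarith

lemma armijo_below_threshold:
  assumes "0 \<le> t" "t \<le> armijo_threshold"
  shows "armijo E ortho \<eta> U D t"
proof (rule armijo_for_small_steps[OF basin_stiefel[OF U] D_tangent assms(1)])
  have K: "C1 * (C0 + L0) > 0"
    using C1_pos C0_pos L0_pos by simp
  have "C1 * (C0 + L0) * t * (norm D)\<^sup>2 \<le> C1 * (C0 + L0) * armijo_threshold * (norm D)\<^sup>2"
    using assms(2) K by (intro mult_right_mono mult_left_mono) auto
  also have "C1 * (C0 + L0) * armijo_threshold = 3/4 * \<nu> * (1 - \<eta>)"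
    unfolding armijo_threshold_def using K
    by (simp only: times_divide_eq_right nonzero_mult_div_cancel_left less_imp_neq[symmetric] not_False_eq_True)
  also have "3/4 * \<nu> * (1 - \<eta>) * (norm D)\<^sup>2 = (1 - \<eta>) * (3/4 * \<nu> * (norm D)\<^sup>2)"
    by simp
  also have "\<dots> \<le> (1 - \<eta>) * - (gradG E U \<bullet> D)"
    using slope_bound \<eta>_less_1 by (intro mult_left_mono) auto
  finally show "C1 * (C0 + L0) * t * (norm D)\<^sup>2 \<le> (1 - \<eta>) * - (gradG E U \<bullet> D)" .
qed

lemma backtracking_terminates: "\<exists>m. armijo E ortho \<eta> U D (init_step E U D * q ^ m)"
proof -
  have i: "0 < init_step E U D"
    using init_step_bounds(1) by linarith
  obtain m where "q ^ m < armijo_threshold / init_step E U D"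
    using real_arch_pow_inv[OF divide_pos_pos[OF armijo_threshold_pos i] q_less_1] by blast
  then have "init_step E U D * q ^ m \<le> armijo_threshold"
    using i by (simp add: pos_less_divide_eq mult.commute)
  then show ?thesis
    using armijo_below_threshold i q_pos by (intro exI[of _ m]) simp
qed

text \<open>
  Unless the initial step is accepted, the step tried just before the accepted one was rejected, so
  it exceeds the Armijo threshold, and the accepted one exceeds \<open>q\<close> times the threshold.
\<close>

lemma accepted_step_bound:
  assumes "\<forall>k<m. \<not> armijo E ortho \<eta> U D (init_step E U D * q ^ k)"
  shows "min (3/4) (q * armijo_threshold) \<le> init_step E U D * q ^ m"
proof (cases m)
  case 0
  then show ?thesis
    using init_step_bounds(1) by simp
next
  case (Suc k)
  then have "\<not> armijo E ortho \<eta> U D (init_step E U D * q ^ k)"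
    using assms by simp
  moreover have "0 \<le> init_step E U D * q ^ k"
    using init_step_bounds(1) q_pos by simp
  ultimately have "armijo_threshold \<le> init_step E U D * q ^ k"
    using armijo_below_threshold by (meson linear)
  then have "q * armijo_threshold \<le> q * (init_step E U D * q ^ k)"
    using q_pos by (intro mult_left_mono) auto
  then show ?thesis
    by (simp add: Suc mult_ac)
qed

text \<open>
  Trial points are at most \<open>C1 * (5/4) * norm D\<close> away from \<open>U\<close>, and
  \<open>norm D \<le> 2 / \<nu> * norm (gradG E U)\<close> is controlled by the distance to the minimizer. They
  stay in the larger ball, hence those of low energy lie in the smaller one.
\<close>

lemma trial_point_in_basin:
  assumes "0 \<le> t" "t \<le> init_step E U D" and low: "E (ortho U D t) \<le> E U"
  shows "ortho U D t \<in> basin"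
proof -
  have Us: "U \<in> stiefel" and EU: "E U \<le> E0" and dU: "grass_dist U Ustar \<le> \<delta>2"
    using U by (simp_all add: basin_def)
  have oS: "ortho U D t \<in> stiefel"
    using ortho_stiefel[OF Us D_tangent] .
  have "norm (gradG E U) \<le> (L0 + C0) * grass_dist U Ustar"
    using norm_gradG_le_grass_dist[OF minimizer Us] .
  also have "\<dots> \<le> (L0 + C0) * \<delta>2"
    using dU L0_pos C0_pos by (intro mult_left_mono) auto
  finally have "\<nu> * norm D \<le> 2 * ((L0 + C0) * \<delta>2)"
    using estimates(4) by linarith
  then have d: "norm D \<le> 2 * ((L0 + C0) * \<delta>2) / \<nu>"
    using \<nu>_pos by (simp add: pos_le_divide_eq mult.commute)
  have "norm (ortho U D t - U) \<le> C1 * t * norm D"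
    using ortho_dist[OF Us D_tangent assms(1)] .
  \<comment> \<open>\<open>3/2\<close> instead of \<open>5/4\<close> gives the constant \<open>3\<close> in the relation of the two radii.\<close>
  also have "\<dots> \<le> C1 * (3/2) * (2 * ((L0 + C0) * \<delta>2) / \<nu>)"
    using assms(1,2) init_step_bounds(2) C1_pos d by (intro mult_mono) auto
  also have "\<dots> = 3 * C1 / \<nu> * (L0 + C0) * \<delta>2"
    by simp
  finally have "grass_dist (ortho U D t) Ustar \<le> \<delta>1"
    using grass_dist_le_add[of "ortho U D t" Ustar U] dU \<delta>2_le by linarith
  moreover have "E (ortho U D t) \<le> E0"
    using low EU by linarith
  ultimately show ?thesis
    using oS level_set_gap by (simp add: basin_def)
qed

end

lemma newton_step_defined_in_basin:
  assumes "U \<in> basin" "gradG E U \<noteq> 0"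
  shows "newton_step_defined E ortho q \<eta> tolerance U"
  unfolding newton_step_defined_def
  using newton_direction_exists[OF basin_stiefel[OF assms(1)] \<nu>_pos
      less_imp_le[OF tolerance_bounds(1)] basin_coercive[OF assms(1)]]
    curvature_pos[OF assms] backtracking_terminates[OF assms]
  by fastforce

text \<open>
  An accepted step of length \<open>t\<close> lowers the energy by at least
  \<open>\<eta> * t * (3/4 * \<nu> * (norm D)\<^sup>2)\<close>; here \<open>t\<close> has its uniform lower bound, and
  \<open>norm (gradG E U) \<le> (L0 + C0 + \<nu>) * norm D\<close> turns \<open>norm D\<close> into the gradient norm.
\<close>

definition decrease_rate :: real where
  "decrease_rate = \<eta> * min (3/4) (q * armijo_threshold) * (3/4 * \<nu>) / (L0 + C0 + \<nu>)\<^sup>2"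

lemma decrease_rate_pos: "0 < decrease_rate"
proof -
  have "0 < L0 + C0 + \<nu>"
    using L0_pos C0_pos \<nu>_pos by simp
  then show ?thesis
    unfolding decrease_rate_def
    using \<eta>_pos q_pos armijo_threshold_pos \<nu>_pos by (intro divide_pos_pos mult_pos_pos) auto
qed

lemma newton_step_in_basin:
  assumes U: "U \<in> basin" and nz: "gradG E U \<noteq> 0"
    and step: "newton_step E ortho q \<eta> tolerance U U'"
  shows "U' \<in> basin" and "E U' \<le> E U - decrease_rate * (norm (gradG E U))\<^sup>2"
proof -
  obtain D m where D: "D \<in> newton_directions E tolerance U"
    and acc: "armijo E ortho \<eta> U D (init_step E U D * q ^ m)"
    and rej: "\<forall>k<m. \<not> armijo E ortho \<eta> U D (init_step E U D * q ^ k)"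
    and U': "U' = ortho U D (init_step E U D * q ^ m)"
    using step unfolding newton_step_def by blast
  define t where "t = init_step E U D * q ^ m"
  let ?t0 = "min (3/4) (q * armijo_threshold)" and ?M = "L0 + C0 + \<nu>"
  have t0: "0 < ?t0" "?t0 \<le> t"
    using q_pos armijo_threshold_pos accepted_step_bound[OF U nz D rej] by (simp_all add: t_def)
  have M: "0 < ?M"
    using L0_pos C0_pos \<nu>_pos by simp
  have "decrease_rate * (norm (gradG E U))\<^sup>2 \<le> decrease_rate * (?M * norm D)\<^sup>2"
    using estimates(3)[OF U nz D] decrease_rate_pos by (intro mult_left_mono power_mono) auto
  also have "\<dots> = \<eta> * (?t0 * (3/4 * \<nu> * (norm D)\<^sup>2))"
    using M by (simp add: decrease_rate_def power_mult_distrib)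
  also have "\<dots> \<le> \<eta> * (t * - (gradG E U \<bullet> D))"
    using t0 slope_bound[OF U nz D] \<eta>_pos \<nu>_pos by (intro mult_left_mono mult_mono) auto
  also have "\<dots> \<le> E U - E U'"
    using acc by (simp add: armijo_def U' t_def)
  finally show dec: "E U' \<le> E U - decrease_rate * (norm (gradG E U))\<^sup>2"
    by linarith
  have "0 \<le> decrease_rate * (norm (gradG E U))\<^sup>2"
    using decrease_rate_pos by simp
  with dec have low: "E (ortho U D t) \<le> E U"
    by (simp add: U' t_def)
  have "t \<le> init_step E U D"
    unfolding t_def using init_step_bounds(1)[OF U nz D] q_pos q_less_1
    by (intro mult_right_le_one_le power_le_one) auto
  then show "U' \<in> basin"
    using trial_point_in_basin[OF U nz D _ _ low] t0 by (simp add: U' t_def)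
qed

lemma newton_iterates_in_basin:
  assumes "U0 \<in> basin" and "newton_iterates E ortho q \<eta> (\<lambda>_. tolerance) U0 U n"
  shows "U n \<in> basin"
proof -
  have "k \<le> n \<Longrightarrow> U k \<in> basin" for k
  proof (induction k)
    case 0
    then show ?case
      using assms by (simp add: newton_iterates_def)
  next
    case (Suc k)
    then have "gradG E (U k) \<noteq> 0" "newton_step E ortho q \<eta> tolerance (U k) (U (Suc k))"
      using assms(2) by (auto simp: newton_iterates_def)
    then show ?case
      using newton_step_in_basin(1) Suc by simp
  qed
  then show ?thesis by simp
qed

lemma newton_sequence_gradG_tendsto_0:
  assumes U0: "U0 \<in> basin" and run: "newton_sequence E ortho q \<eta> (\<lambda>_. tolerance) U0 U"
    and nz: "\<And>n. gradG E (U n) \<noteq> 0"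
  shows "(\<lambda>n. norm (gradG E (U n))) \<longlonglongrightarrow> 0"
proof -
  have it: "newton_iterates E ortho q \<eta> (\<lambda>_. tolerance) U0 U n" for n
    using run nz by (simp add: newton_sequence_def)
  have B: "U n \<in> basin" for n
    using newton_iterates_in_basin[OF U0 it] .
  obtain b where b: "\<forall>V\<in>stiefel. b \<le> E V"
    using E_bounded_below by blast
  show ?thesis
  proof (rule tendsto_zero_of_sufficient_decrease[OF decrease_rate_pos])
    show "b \<le> E (U n)" for n
      using b basin_stiefel[OF B] by blast
    have "newton_step E ortho q \<eta> tolerance (U n) (U (Suc n))" for n
      using it[of "Suc n"] by (simp add: newton_iterates_def)
    then show "E (U (Suc n)) \<le> E (U n) - decrease_rate * (norm (gradG E (U n)))\<^sup>2" for n
      using newton_step_in_basin(2)[OF B nz] by blast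
  qed
qed

end

section \<open>Convergence of the line search Newton method\<close>

theorem theorem3p7:
  fixes L Vext :: "real ^ 'g ^ 'g"
    and exc :: "real ^ 'g \<Rightarrow> real ^ 'g"
    and E :: "real ^ 'n ^ 'g \<Rightarrow> real"
    and \<Omega> :: "(real ^ 'n ^ 'g) set"
    and ortho :: "real ^ 'n ^ 'g \<Rightarrow> real ^ 'n ^ 'g \<Rightarrow> real \<Rightarrow> real ^ 'n ^ 'g"
    and Ustar U0 :: "real ^ 'n ^ 'g"
    and L0 L1 C0 C1 \<delta>1 \<delta>2 \<nu>1 E0 q \<eta> :: real
  assumes "CARD('n) \<le> CARD('g)"
    and "transpose L = L" and "transpose Vext = Vext"
    and "E = ks_energy L Vext exc"
    and "open \<Omega>" and "stiefel \<subseteq> \<Omega>" and "Ck_on 3 E \<Omega>"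
    and "L0 > 0"
    and "\<forall>U\<in>stiefel. \<forall>V\<in>stiefel. norm (grad E U - grad E V) \<le> L0 * norm (U - V)"
    and "C0 > 0" and "\<forall>\<Psi>\<in>stiefel. norm (grad E \<Psi>) \<le> C0"
    and "L1 = L0 + 2 * C0"
    and "grass_local_minimizer E Ustar"
    and "\<delta>1 > 0" and "\<nu>1 > 0"
    and "\<forall>U\<in>stiefel. gclass U \<in> grass_ball Ustar \<delta>1 \<longrightarrow>
           (\<forall>D\<in>tangent U. hessG E U D \<bullet> D \<ge> \<nu>1 * (norm D)\<^sup>2)"
    and "\<forall>U\<in>stiefel. \<forall>D\<in>tangent U. \<forall>t. ortho U D t \<in> stiefel"
    and "smooth_on_subset (\<lambda>(U, D, t). ortho U D t) {(U, D, t). U \<in> stiefel \<and> D \<in> tangent U}"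
    and "\<forall>U\<in>stiefel. \<forall>D\<in>tangent U. ortho U D 0 = U"
    and "\<forall>U\<in>stiefel. \<forall>D\<in>tangent U. ((\<lambda>t. ortho U D t) has_vector_derivative D) (at 0)"
    and "C1 > 0"
    and "\<forall>U\<in>stiefel. \<forall>D\<in>tangent U. \<forall>t\<ge>0. norm (ortho U D t - U) \<le> C1 * t * norm D"
    and "\<forall>U\<in>stiefel. \<forall>D\<in>tangent U. \<forall>t\<ge>0.
           norm (vector_derivative (\<lambda>s. ortho U D s) (at t) - D) \<le> C1 * t * (norm D)\<^sup>2"
    and "0 < \<delta>2" and "\<delta>2 < \<delta>1 / (1 + 3 * C1 / \<nu>1 * L1)"
    and "E0 > E Ustar"
    and "level_set E E0 \<inter> grass_ball Ustar \<delta>1 \<subseteq> grass_ball Ustar \<delta>2"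
    and "0 < q" and "q < 1" and "0 < \<eta>" and "\<eta> < 1 / 4"
    and "U0 \<in> stiefel" and "gclass U0 \<in> grass_ball Ustar \<delta>2 \<inter> level_set E E0"
  shows "\<exists>\<sigma> :: (real ^ 'n ^ 'g) list \<Rightarrow> real.
           (\<forall>h. 0 < \<sigma> h \<and> \<sigma> h < 1) \<and>
           (\<forall>U n. newton_iterates E ortho q \<eta> \<sigma> U0 U n \<and> norm (gradG E (U n)) \<noteq> 0 \<longrightarrow>
              newton_step_defined E ortho q \<eta> (\<sigma> (map U [0..<Suc n])) (U n)) \<and>
           (\<forall>U. newton_sequence E ortho q \<eta> \<sigma> U0 U \<longrightarrow>
              (\<exists>n. norm (gradG E (U n)) = 0) \<or>
              (\<lambda>n. norm (gradG E (U n))) \<longlonglongrightarrow> 0)"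
proof -
  note E = assms(4) and open_\<Omega> = assms(5) and \<Omega> = assms(6) and C3 = assms(7)
    and L0 = assms(8) and C0 = assms(10) and L1 = assms(12)
    and \<nu>1 = assms(15) and coercive = assms(16) and smooth = assms(18) and C1 = assms(21)
    and \<delta>2 = assms(24,25) and gap = assms(27) and U0 = assms(32,33)
  have E_inv: "E (U ** P) = E U" if "orthogonal_matrix P" for U P
    unfolding E using that by (rule ks_energy_mult_orthogonal)
  have C3': "Ck_on (Suc (Suc (Suc 0))) E \<Omega>"
    using C3 by (simp add: numeral_3_eq_3)
  have diff: "(\<lambda>t. ortho U D t) differentiable (at t)" if "U \<in> stiefel" "D \<in> tangent U" for U D t
  proof -
    have "(\<lambda>s. (\<lambda>(U, D, t). ortho U D t) (U, D, s)) differentiable (at t)"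
      by (rule differentiable_curve_of_smooth_on_subset[OF smooth])
        (use that in \<open>auto intro!: differentiable_Pair\<close>)
    then show ?thesis by simp
  qed
  interpret stiefel_energy E ortho L0 C0 C1
  proof
    show "GDERIV E U :> grad E U" if "U \<in> stiefel" for U
      using that \<Omega> by (intro GDERIV_grad(1) Ck_on_imp_differentiable[OF C3' open_\<Omega>]) auto
    show "grad E differentiable (at U)" if "U \<in> stiefel" for U
      using that \<Omega> by (intro Ck_on_imp_grad_differentiable[OF C3' open_\<Omega>]) auto
  qed (use L0 C0 C1 E_inv diff assms(9,11,17,19,20,22,23) in simp_all)
  interpret newton_basin E ortho L0 C0 C1 Ustar \<delta>1 \<delta>2 \<nu>1 E0 q \<eta>
  proof
    show "hessG E U D \<bullet> D \<ge> \<nu>1 * (norm D)\<^sup>2"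
      if "U \<in> stiefel" "grass_dist U Ustar \<le> \<delta>1" "D \<in> tangent U" for U D
      using coercive that by (simp add: gclass_in_grass_ball_iff)
    show "\<delta>2 + 3 * C1 / \<nu>1 * (L0 + C0) * \<delta>2 \<le> \<delta>1"
    proof -
      have "0 < 3 * C1 / \<nu>1 * L1"
        using C1 \<nu>1 L0 C0 L1 by simp
      then have "\<delta>2 * (1 + 3 * C1 / \<nu>1 * L1) < \<delta>1"
        using \<delta>2(2) by (simp only: pos_less_divide_eq add_pos_pos zero_less_one)
      moreover have "3 * C1 / \<nu>1 * (L0 + C0) * \<delta>2 \<le> 3 * C1 / \<nu>1 * L1 * \<delta>2"
        using C1 \<nu>1 C0 L1 \<delta>2(1) by (intro mult_right_mono mult_left_mono) auto
      ultimately show ?thesis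
        by (simp only: distrib_left mult_1_right mult.commute[of \<delta>2])
    qed
    show "grass_dist U Ustar \<le> \<delta>2"
      if "U \<in> stiefel" "E U \<le> E0" "grass_dist U Ustar \<le> \<delta>1" for U
    proof -
      have "gclass U \<in> level_set E E0 \<inter> grass_ball Ustar \<delta>1"
        using that by (simp add: gclass_in_grass_ball_iff gclass_in_level_set_iff[OF _ E_inv])
      then show ?thesis
        using gap gclass_in_grass_ball_iff[OF that(1)] by blast
    qed
  qed (use \<nu>1 \<delta>2 assms(13,28-31) in simp_all)
  have "U0 \<in> basin"
    using U0 by (simp add: basin_def gclass_in_grass_ball_iff gclass_in_level_set_iff[OF _ E_inv])
  then show ?thesis
    using tolerance_bounds newton_step_defined_in_basin newton_iterates_in_basin
      newton_sequence_gradG_tendsto_0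
    by (intro exI[of _ "\<lambda>_. tolerance"]) (simp, metis)
qed

end
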